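(* Consider reliance profiles in the continuous idealization $n\to\infty$ (proportions may be arbitrary reals). Let $Acc_{AI}\in(50\%,100\%]$ and $\mathcal{A}\in[0\%,100\%]$ be given. (1) If the human under-relies at a degree of $\mathcal{A}<2\cdot Acc_{AI}-100\%$, then every reliance profile with AI accuracy $Acc_{AI}$ and degree of adherence $\mathcal{A}$ satisfies $Acc_{final}<Acc_{AI}$. (2) If $\mathcal{A}>2\cdot Acc_{AI}-100\%$, then achieving a final decision-making accuracy greater than the AI accuracy is possible, i.e., there exists a reliance profile with AI accuracy $Acc_{AI}$ and degree of adherence $\mathcal{A}$ for which $Acc_{final}>Acc_{AI}$.
   Context: Percentages are real numbers with $100\%=1$. A binary decision task has $n$ AI recommendations, each correct or wrong; a human either adheres to or overrides each one. A reliance profile is a quadruple of nonnegative real proportions $(\mathcal{A}_{correct},\mathcal{A}_{wrong},\mathcal{O}_{correct},\mathcal{O}_{wrong})$ with $\mathcal{A}_{correct}+\mathcal{A}_{wrong}+\mathcal{O}_{correct}+\mathcal{O}_{wrong}=100\%$, where $\mathcal{A}_{correct}$ is the share of recommendations that are correct and adhered to, $\mathcal{A}_{wrong}$ wrong and adhered to, $\mathcal{O}_{correct}$ wrong and overridden, $\mathcal{O}_{wrong}$ correct and overridden. The convention $n\to\infty$ means these proportions may be any real numbers subject to these constraints (no rounding). For a profile, define the degree of adherence $\mathcal{A}=\mathcal{A}_{correct}+\mathcal{A}_{wrong}$, the AI accuracy $Acc_{AI}=\mathcal{A}_{correct}+\mathcal{O}_{wrong}$, and the final decision-making accuracy $Acc_{final}=\mathcal{A}_{correct}+\mathcal{O}_{correct}$.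 Under-reliance means $\mathcal{A}<Acc_{AI}$; this holds automatically when $\mathcal{A}<2\cdot Acc_{AI}-100\%$, since $2\cdot Acc_{AI}-100\%\leq Acc_{AI}$.
   Formalization: In part (2) the degree of adherence is additionally assumed to be below 100%: at full adherence every profile has final accuracy equal to the AI accuracy (e.g. AI accuracy 75%, adherence 100%), so the claim as written fails there. *)

theory Defs
  imports Complex_Main
begin

text \<open>Percentages are real numbers, with 100 percent being 1.\<close>

record reliance_profile =
  A_correct :: real  \<comment> \<open>share of recommendations that are correct and adhered to\<close>
  A_wrong :: real    \<comment> \<open>wrong and adhered to\<close>
  O_correct :: real  \<comment> \<open>wrong and overridden\<close>
  O_wrong :: real    \<comment> \<open>correct and overridden\<close>

text \<open>No rounding to multiples of \<open>1/n\<close> is imposed: this is the idealization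
  in which the number \<open>n\<close> of recommendations tends to infinity.\<close>

definition is_reliance_profile :: "reliance_profile \<Rightarrow> bool" where
  "is_reliance_profile P \<longleftrightarrow>
     0 \<le> A_correct P \<and> 0 \<le> A_wrong P \<and> 0 \<le> O_correct P \<and> 0 \<le> O_wrong P \<and>
     A_correct P + A_wrong P + O_correct P + O_wrong P = 1"

definition adherence :: "reliance_profile \<Rightarrow> real" where
  "adherence P = A_correct P + A_wrong P"

definition Acc_AI :: "reliance_profile \<Rightarrow> real" where
  "Acc_AI P = A_correct P + O_wrong P"

definition Acc_final :: "reliance_profile \<Rightarrow> real" where
  "Acc_final P = A_correct P + O_correct P"

definition under_reliance :: "reliance_profile \<Rightarrow> bool" where
  "under_reliance P \<longleftrightarrow> adherence P < Acc_AI P"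

lemma under_reliance_if_adherence_less:
  assumes "is_reliance_profile P" and "adherence P < 2 * Acc_AI P - 1"
  shows "under_reliance P"
  using assms
  by (simp add: is_reliance_profile_def adherence_def Acc_AI_def under_reliance_def)

text \<open>Full adherence leaves no room for improvement over the AI, so a bound
  \<open>adherence > 2 * Acc_AI - 1\<close> alone does not make \<open>Acc_final > Acc_AI\<close> attainable:
  the value 1 of the degree of adherence has to be excluded.\<close>

lemma Acc_final_eq_Acc_AI_if_full_adherence:
  assumes "is_reliance_profile P" and "adherence P = 1"
  shows "Acc_final P = Acc_AI P"
  using assms
  by (simp add: is_reliance_profile_def adherence_def Acc_AI_def Acc_final_def)

end

theory Submission
  imports Defs
begin

text \<open>The four shares are determined by \<open>Acc_AI\<close>, \<open>adherence\<close> and \<open>A_wrong\<close>, and the gain over the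
  AI is decreasing in \<open>A_wrong\<close>. Part (1) is the bound \<open>A_wrong \<ge> 0\<close>; for part (2) one takes the
  least admissible value \<open>A_wrong = max 0 (adherence - Acc_AI)\<close>.\<close>

text \<open>Correct adherence counts in both accuracies, so the gain is
  \<open>O_correct - O_wrong\<close>; here \<open>O_wrong\<close> =
  \<open>Acc_AI - adherence + A_wrong\<close>, and the total of 1 then fixes
  \<open>O_correct\<close>.\<close>

lemma Acc_final_minus_Acc_AI:
  assumes "is_reliance_profile P"
  shows "Acc_final P - Acc_AI P = adherence P - (2 * Acc_AI P - 1) - 2 * A_wrong P"
  using assms
  by (simp add: is_reliance_profile_def adherence_def Acc_AI_def Acc_final_def)

theorem corollary1:
  fixes acc adh :: real
  assumes "1 / 2 < acc" and "acc \<le> 1"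
    and "0 \<le> adh" and "adh \<le> 1"
  shows "(adh < 2 * acc - 1 \<longrightarrow>
            (\<forall>P. is_reliance_profile P \<and> Acc_AI P = acc \<and> adherence P = adh \<longrightarrow>
                 Acc_final P < Acc_AI P)) \<and>
         (2 * acc - 1 < adh \<and> adh < 1 \<longrightarrow>
            (\<exists>P. is_reliance_profile P \<and> Acc_AI P = acc \<and> adherence P = adh \<and>
                 Acc_final P > Acc_AI P))"
proof (intro conjI impI allI)
  fix P
  assume less: "adh < 2 * acc - 1"
    and P: "is_reliance_profile P \<and> Acc_AI P = acc \<and> adherence P = adh"
  from P have "0 \<le> A_wrong P"
    by (simp add: is_reliance_profile_def)
  with less P Acc_final_minus_Acc_AI[of P] show "Acc_final P < Acc_AI P"
    by simp
next
  assume adh: "2 * acc - 1 < adh \<and> adh < 1"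
  \<comment> \<open>If \<open>adh \<le> acc\<close>, every wrong recommendation is overridden and
    the gain is \<open>adh - (2 * acc - 1)\<close>. Otherwise every correct one is adhered to and
    the gain is \<open>1 - adh\<close>, positive because \<open>adh < 1\<close>.\<close>
  define P where "P = \<lparr>A_correct = min acc adh, A_wrong = max 0 (adh - acc),
    O_correct = min (1 - acc) (1 - adh), O_wrong = max 0 (acc - adh)\<rparr>"
  have "is_reliance_profile P \<and> Acc_AI P = acc \<and> adherence P = adh \<and> Acc_final P > Acc_AI P"
    using assms adh
    by (auto simp: P_def is_reliance_profile_def Acc_AI_def adherence_def Acc_final_def
        min_def max_def)
  then show "\<exists>P. is_reliance_profile P \<and> Acc_AI P = acc \<and> adherence P = adh \<and>
      Acc_final P > Acc_AI P" ..
qed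

end
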